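(* For every integer $j$ set $h_{1,j}(\tau):=\theta_{1,j+1}(\tau)$. Recursively, for $\ell\in\mathbb N$, given functions $h_{\ell,c}(\tau)$ for $0\le c<2\ell$, define for integers $0\le b\le \ell+1$ \[ \begin{split} h_{\ell+1,b}(\tau) & := h_{1,b}(\tau)\,\theta_{\ell(\ell+1),b\ell}(\tau)\,h_{\ell,0}(\tau) +h_{1,b-\ell}(\tau)\,\theta_{\ell(\ell+1),b\ell-\ell(\ell+1)}(\tau)\,h_{\ell,\ell}(\tau) \\ & \quad + \sum_{c=1}^{\ell-1} h_{1,b-c}(\tau) \big( \theta_{\ell(\ell+1),b\ell-c(\ell+1)}(\tau) +\theta_{\ell(\ell+1),b\ell+c(\ell+1)}(\tau) \big) h_{\ell,c}(\tau), \end{split} \] and for every integer $b$ \[ h_{\ell+\frac12,b+\frac12}(\tau) := \sum_{c=0}^{2\ell-1} h_{\ell,c}(\tau)\,\theta_{\ell(2\ell+1),\,c(2\ell+1)-\ell(2b+1)}(\tau), \] and for $\ell<b\le 2\ell$ set $h_{\ell,b}(\tau):=h_{\ell,2\ell-b}(\tau)$. Then for all $\ell\in\mathbb N$ and $\delta\in\{0,1\}$, \[ (-1)^{\delta}\,\vartheta\Big(z+\tfrac12;\tau\Big)^{2\ell+\delta} = \sum_{b=0}^{2\ell+\delta-1} h_{\ell+\frac{\delta}{2},\,b+\frac{\delta}{2}}(\tau)\,\vartheta_{\ell+\frac{\delta}{2},\,b+\frac{\delta}{2}}(z;\tau). \]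
   Context: Let $\tau$ lie in the complex upper half-plane, $z\in\mathbb C$, $q:=e^{2\pi i\tau}$, and $\zeta^x:=e^{2\pi i x z}$ for real $x$. The Jacobi theta function is $\vartheta(z;\tau):=\sum_{n\in\frac12+\mathbb Z}e^{\pi i n^2\tau+2\pi i n(z+\frac12)}$. For $m$ a positive integer or positive half-integer and $a$ an integer or half-integer, $\vartheta_{m,a}(z;\tau):=\sum_{n\in\mathbb Z}q^{\frac{(2mn+a)^2}{4m}}\zeta^{2mn+a}$ and $\theta_{m,a}(\tau):=\vartheta_{m,a}(0;\tau)=\sum_{n\in\mathbb Z}q^{\frac{(2mn+a)^2}{4m}}$. *)

theory Defs
  imports "HOL-Analysis.Analysis"
begin

text \<open>
  Throughout, \<open>q\<^sup>x = exp (2\<pi>i x \<tau>)\<close> and \<open>\<zeta>\<^sup>x = exp (2\<pi>i x z)\<close> for real \<open>x\<close>.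
\<close>

definition q_pow :: "complex \<Rightarrow> real \<Rightarrow> complex" where
  "q_pow \<tau> x = exp (2 * of_real pi * \<i> * of_real x * \<tau>)"

definition zeta_pow :: "complex \<Rightarrow> real \<Rightarrow> complex" where
  "zeta_pow z x = exp (2 * of_real pi * \<i> * of_real x * z)"

definition jacobi_theta :: "complex \<Rightarrow> complex \<Rightarrow> complex" where
  "jacobi_theta z \<tau> =
     (\<Sum>\<^sub>\<infinity>n\<in>range (\<lambda>k::int. 1 / 2 + real_of_int k).
        exp (of_real pi * \<i> * of_real (n\<^sup>2) * \<tau> + 2 * of_real pi * \<i> * of_real n * (z + 1 / 2)))"

definition vartheta :: "real \<Rightarrow> real \<Rightarrow> complex \<Rightarrow> complex \<Rightarrow> complex" where
  "vartheta m a z \<tau> =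
     (\<Sum>\<^sub>\<infinity>n\<in>(UNIV :: int set).
        q_pow \<tau> ((2 * m * of_int n + a)\<^sup>2 / (4 * m)) * zeta_pow z (2 * m * of_int n + a))"

definition theta :: "real \<Rightarrow> real \<Rightarrow> complex \<Rightarrow> complex" where
  "theta m a \<tau> = vartheta m a 0 \<tau>"

text \<open>
  \<open>h_int \<ell> b\<close> is \<open>h\<^bsub>\<ell>,b\<^esub>\<close>, for all integers \<open>b\<close> if \<open>\<ell> = 1\<close> and for \<open>0 \<le> b \<le> 2\<ell>\<close> if \<open>\<ell> \<ge> 2\<close>;
  it is left unspecified elsewhere.  In the third equation \<open>l = \<ell>\<close>, and the level defined is \<open>\<ell> + 1\<close>.
\<close>

function h_int :: "nat \<Rightarrow> int \<Rightarrow> complex \<Rightarrow> complex" where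
  "h_int 0 b \<tau> = undefined"
| "h_int (Suc 0) b \<tau> = theta 1 (of_int (b + 1)) \<tau>"
| "h_int (Suc (Suc k)) b \<tau> =
     (let l = int (Suc k) in
      if 0 \<le> b \<and> b \<le> l + 1 then
        h_int 1 b \<tau> * theta (of_int (l * (l + 1))) (of_int (b * l)) \<tau> * h_int (Suc k) 0 \<tau>
        + h_int 1 (b - l) \<tau> * theta (of_int (l * (l + 1))) (of_int (b * l - l * (l + 1))) \<tau>
            * h_int (Suc k) l \<tau>
        + (\<Sum>c = 1..l - 1. h_int 1 (b - c) \<tau>
             * (theta (of_int (l * (l + 1))) (of_int (b * l - c * (l + 1))) \<tau>
                + theta (of_int (l * (l + 1))) (of_int (b * l + c * (l + 1))) \<tau>)
             * h_int (Suc k) c \<tau>)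
      else if l + 1 < b \<and> b \<le> 2 * (l + 1) then h_int (Suc (Suc k)) (2 * (l + 1) - b) \<tau>
      else undefined)"
  by pat_completeness auto
termination
  by (relation "measures [\<lambda>(l, b, \<tau>). l, \<lambda>(l, b, \<tau>). nat b]") auto

text \<open>\<open>h_half \<ell> b\<close> is \<open>h\<^bsub>\<ell>+1/2,b+1/2\<^esub>\<close>.\<close>

definition h_half :: "nat \<Rightarrow> int \<Rightarrow> complex \<Rightarrow> complex" where
  "h_half l b \<tau> =
     (\<Sum>c = 0..2 * int l - 1. h_int l c \<tau>
        * theta (of_int (int l * (2 * int l + 1)))
            (of_int (c * (2 * int l + 1) - int l * (2 * b + 1))) \<tau>)"

text \<open>\<open>h_coeff \<ell> \<delta> b\<close> is \<open>h\<^bsub>\<ell>+\<delta>/2,b+\<delta>/2\<^esub>\<close> for \<open>\<delta> \<in> {0,1}\<close>.\<close>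

definition h_coeff :: "nat \<Rightarrow> nat \<Rightarrow> int \<Rightarrow> complex \<Rightarrow> complex" where
  "h_coeff l \<delta> b \<tau> = (if \<delta> = 0 then h_int l b \<tau> else h_half l b \<tau>)"

end

theory Submission
  imports Defs
begin

text \<open>Since \<open>e\<^bsup>2\<pi>in\<^esup> = -1\<close> for half-integral \<open>n\<close>, the shifted Jacobi theta function is \<open>-T\<close> with
  \<open>T = \<vartheta>\<^bsub>1/2,1/2\<^esub>\<close>.  A product of two of the functions \<open>\<vartheta>\<^bsub>m,a\<^esub>\<close> expands, after a change of lattice
  coordinates, into functions \<open>\<vartheta>\<close> whose index is the sum of the two indices, with Thetanullwerte as
  coefficients.  Multiplying the expansion of \<open>T\<^bsup>2\<ell>\<^esup>\<close> by \<open>T\<^sup>2\<close> or by \<open>T\<close> gives the one of the next even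
  or odd power; the symmetry \<open>h\<^bsub>\<ell>,2\<ell>-c\<^esub> = h\<^bsub>\<ell>,c\<^esub>\<close> folds the coefficient sum over \<open>0 \<le> c < 2\<ell>\<close> into the
  recursion for \<open>h\<close>.\<close>

section \<open>Absolute convergence of theta series and of their products\<close>

lemma summable_on_exp_neg_abs_int: "(\<lambda>n::int. exp (- \<bar>real_of_int n\<bar>)) summable_on UNIV"
proof -
  have geo: "(\<lambda>n::nat. exp (- real n)) summable_on UNIV"
  proof (rule norm_summable_imp_summable_on)
    have "summable (\<lambda>n::nat. exp (-1::real) ^ n)"
      by (rule summable_geometric) simp
    thus "summable (\<lambda>n::nat. norm (exp (- real n)))"
      by (simp add: exp_of_nat_mult[symmetric])
  qed
  have "(\<lambda>n::int. exp (- \<bar>real_of_int n\<bar>)) summable_on range int"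
    using geo by (subst summable_on_reindex) (auto simp: o_def)
  moreover have "(\<lambda>n::int. exp (- \<bar>real_of_int n\<bar>)) summable_on range (\<lambda>n. - int n)"
    using geo by (subst summable_on_reindex) (auto simp: o_def inj_on_def)
  ultimately have "(\<lambda>n::int. exp (- \<bar>real_of_int n\<bar>)) summable_on (range int \<union> range (\<lambda>n. - int n))"
    by (rule summable_on_union)
  moreover have "range int \<union> range (\<lambda>n. - int n) = UNIV"
  proof -
    have "n \<in> range int \<union> range (\<lambda>n. - int n)" for n
      by (cases n rule: int_cases2) auto
    thus ?thesis by blast
  qed
  ultimately show ?thesis by simp
qed

lemma summable_on_exp_quadratic:
  fixes \<alpha> \<beta> \<gamma> :: real
  assumes "\<alpha> > 0"
  shows "(\<lambda>n::int. exp (- (\<alpha> * (real_of_int n)\<^sup>2) + \<beta> * of_int n + \<gamma>)) summable_on UNIV"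
proof -
  \<comment> \<open>The quadratic
    \<open>(\<bar>\<beta>\<bar> + 1) * \<bar>x\<bar> - \<alpha> * x^2\<close> has maximum
    \<open>(\<bar>\<beta>\<bar> + 1)^2 / (4 * \<alpha>)\<close>. The extra 1 beside
    \<open>\<bar>\<beta>\<bar>\<close> pays for the decay \<open>- \<bar>x\<bar>\<close> needed in
    the comparison.\<close>
  define C where "C = \<gamma> + (\<bar>\<beta>\<bar> + 1)\<^sup>2 / (4 * \<alpha>)"
  have bound: "- (\<alpha> * x\<^sup>2) + \<beta> * x + \<gamma> \<le> C - \<bar>x\<bar>" for x :: real
  proof -
    have "0 \<le> (2 * \<alpha> * \<bar>x\<bar> - (\<bar>\<beta>\<bar> + 1))\<^sup>2" by simp
    also have "\<dots> = 4 * \<alpha> * (\<alpha> * x\<^sup>2 - (\<bar>\<beta>\<bar> + 1) * \<bar>x\<bar> + (\<bar>\<beta>\<bar> + 1)\<^sup>2 / (4 * \<alpha>))"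
      using assms by (simp add: field_simps power2_eq_square)
    finally have "0 \<le> \<alpha> * x\<^sup>2 - (\<bar>\<beta>\<bar> + 1) * \<bar>x\<bar> + (\<bar>\<beta>\<bar> + 1)\<^sup>2 / (4 * \<alpha>)"
      using assms by (simp add: zero_le_mult_iff)
    moreover have "\<beta> * x \<le> \<bar>\<beta>\<bar> * \<bar>x\<bar>"
      by (metis abs_ge_self abs_mult)
    ultimately show ?thesis by (simp add: C_def algebra_simps)
  qed
  have "(\<lambda>n::int. exp C * exp (- \<bar>real_of_int n\<bar>)) summable_on UNIV"
    by (intro summable_on_cmult_right summable_on_exp_neg_abs_int)
  hence "(\<lambda>n::int. norm (exp (- (\<alpha> * (real_of_int n)\<^sup>2) + \<beta> * of_int n + \<gamma>))) summable_on UNIV"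
    by (rule Infinite_Sum.abs_summable_on_comparison_test')
       (simp flip: exp_add add: bound[simplified])
  thus ?thesis by simp
qed

lemma vartheta_summable:
  assumes "Im \<tau> > 0" "m > 0"
  shows "(\<lambda>n::int. q_pow \<tau> ((2 * m * of_int n + a)\<^sup>2 / (4 * m)) * zeta_pow z (2 * m * of_int n + a))
           summable_on UNIV"
proof (rule abs_summable_summable)
  \<comment> \<open>Coefficients of the exponent of the norm: \<open>q_pow \<tau> x\<close> has norm
    \<open>exp (- 2 * pi * x * Im \<tau>)\<close>, \<open>zeta_pow z x\<close> has norm
    \<open>exp (- 2 * pi * x * Im z)\<close>, and \<open>(2*m*n + a)^2 / (4*m)\<close> equals
    \<open>m*n^2 + a*n + a^2 / (4*m)\<close>.\<close>
  define \<alpha> \<beta> \<gamma> where "\<alpha> = 2 * pi * m * Im \<tau>" and "\<beta> = - 2 * pi * a * Im \<tau> - 4 * pi * m * Im z"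
    and "\<gamma> = - 2 * pi * Im \<tau> * a\<^sup>2 / (4 * m) - 2 * pi * a * Im z"
  have "norm (q_pow \<tau> ((2 * m * of_int n + a)\<^sup>2 / (4 * m)) * zeta_pow z (2 * m * of_int n + a))
    = exp (- (\<alpha> * (real_of_int n)\<^sup>2) + \<beta> * of_int n + \<gamma>)" for n :: int
    using assms(2)
    by (simp add: q_pow_def zeta_pow_def \<alpha>_def \<beta>_def \<gamma>_def norm_mult flip: exp_add)
       (simp add: field_simps power2_eq_square)
  thus "(\<lambda>n::int. norm (q_pow \<tau> ((2 * m * of_int n + a)\<^sup>2 / (4 * m)) * zeta_pow z (2 * m * of_int n + a)))
     summable_on UNIV"
    using summable_on_exp_quadratic[of \<alpha> \<beta> \<gamma>] assms by (simp add: \<alpha>_def)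
qed

text \<open>Complex summability is absolute, so the norms of the products are summable over
  \<open>A \<times> B\<close> and Fubini applies.\<close>

lemma
  fixes F :: "'a \<Rightarrow> complex" and G :: "'b \<Rightarrow> complex"
  assumes F: "F summable_on A" and G: "G summable_on B"
  shows summable_on_product: "(\<lambda>(x, y). F x * G y) summable_on A \<times> B"
    and infsum_product: "infsum (\<lambda>(x, y). F x * G y) (A \<times> B) = infsum F A * infsum G B"
proof -
  have "(\<lambda>x. norm (F x)) summable_on A" "(\<lambda>y. norm (G y)) summable_on B"
    using assms by (simp_all add: summable_on_iff_abs_summable_on_complex)
  hence "(\<lambda>xy. norm (case xy of (x, y) \<Rightarrow> F x * G y)) summable_on A \<times> B"
    by (subst Infinite_Sum.abs_summable_on_Sigma_iff)
       (auto simp: norm_mult infsum_cmult_right' abs_mult infsum_nonneg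
             intro!: summable_on_cmult_right summable_on_cmult_left)
  thus s: "(\<lambda>(x, y). F x * G y) summable_on A \<times> B"
    by (rule Infinite_Sum.abs_summable_summable)
  have "infsum (\<lambda>(x, y). F x * G y) (A \<times> B) = infsum (\<lambda>x. infsum (\<lambda>y. F x * G y) B) A"
    using infsum_Sigma'_banach[OF s] by simp
  thus "infsum (\<lambda>(x, y). F x * G y) (A \<times> B) = infsum F A * infsum G B"
    by (simp add: infsum_cmult_right' infsum_cmult_left')
qed

section \<open>Periodicity and parity in the second parameter\<close>

lemma vartheta_shift: "vartheta m (a + 2 * m * of_int k) z \<tau> = vartheta m a z \<tau>"
  unfolding vartheta_def
  by (rule infsum_reindex_bij_witness[where i = "\<lambda>n. n - k" and j = "\<lambda>n. n + k"])
     (auto simp: algebra_simps)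

lemma theta_shift: "theta m (a + 2 * m * of_int k) \<tau> = theta m a \<tau>"
  by (simp add: theta_def vartheta_shift)

text \<open>The reversal \<open>n -> -n\<close> keeps the square; the sign change of the zeta
  exponent is harmless because \<open>z = 0\<close>.\<close>

lemma theta_minus: "theta m (- a) \<tau> = theta m a \<tau>"
  unfolding theta_def vartheta_def
proof (rule infsum_reindex_bij_witness[where i = uminus and j = uminus])
  fix n :: int
  have "(2 * m * real_of_int (- n) + a)\<^sup>2 = (2 * m * real_of_int n + - a)\<^sup>2"
    by (simp add: power2_eq_square algebra_simps)
  thus "q_pow \<tau> ((2 * m * real_of_int (- n) + a)\<^sup>2 / (4 * m)) * zeta_pow 0 (2 * m * real_of_int (- n) + a) =
        q_pow \<tau> ((2 * m * real_of_int n + - a)\<^sup>2 / (4 * m)) * zeta_pow 0 (2 * m * real_of_int n + - a)"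
    by (simp add: zeta_pow_def)
qed auto

text \<open>This rule and the next reduce equality of Thetanullwerte to a congruence modulo
  \<open>2 * m\<close>, the next one up to sign. Once \<open>k\<close> is named, only an algebraic
  identity remains.\<close>

lemma theta_eqI: "a = b + 2 * m * of_int k \<Longrightarrow> theta m a \<tau> = theta m b \<tau>"
  by (simp add: theta_shift)

lemma theta_eqI_minus: "a = - b + 2 * m * of_int k \<Longrightarrow> theta m a \<tau> = theta m b \<tau>"
  using theta_shift[of m "- b" k \<tau>] by (simp add: theta_minus)

section \<open>Product formula for two theta functions\<close>

text \<open>With \<open>A = pLn + a\<close>, \<open>B = pn' + a'\<close> and \<open>s = A + B\<close>, completing the square gives
  \<open>A\<^sup>2/(2pL) + B\<^sup>2/(2p) = s\<^sup>2/(2p(L+1)) + (A - LB)\<^sup>2/(2pL(L+1))\<close>; the lattice of pairs \<open>(n, n')\<close> is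
  split by division with remainder, \<open>n' + Ln = (L+1)K + t\<close>.\<close>

lemma vartheta_mult:
  fixes L :: nat and p a a' :: real
  assumes "Im \<tau> > 0" "p > 0" "L \<ge> 1"
  shows "vartheta (p * L / 2) a z \<tau> * vartheta (p / 2) a' z \<tau> =
    (\<Sum>t=0..int L. vartheta (p * (L + 1) / 2) (p * of_int t + a + a') z \<tau>
        * theta (p * L * (L + 1) / 2) (a - L * a' - L * p * of_int t) \<tau>)"
proof -
  define F where "F m a z n = q_pow \<tau> ((2 * m * of_int n + a)\<^sup>2 / (4 * m)) * zeta_pow z (2 * m * of_int n + a)"
    for m a z and n :: int
  have v: "vartheta m a z \<tau> = infsum (F m a z) UNIV" for m a z
    by (simp add: vartheta_def F_def[abs_def])
  have sF: "F m a z summable_on UNIV" if "m > 0" for m a z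
    using vartheta_summable[OF assms(1) that] by (simp add: F_def[abs_def])
  let ?G = "\<lambda>t (K, N). F (p * (L + 1) / 2) (p * of_int t + a + a') z K
        * F (p * L * (L + 1) / 2) (a - L * a' - L * p * of_int t) 0 N"
  let ?H = "\<lambda>(n, n'). F (p * L / 2) a z n * F (p / 2) a' z n'"
  \<comment> \<open>In these coordinates \<open>L*n + n' = (L+1)*K + t\<close> and
    \<open>n - n' = (L+1)*N - t\<close>. Hence \<open>A + B\<close> depends on \<open>K\<close>
    alone and \<open>A - L*B\<close> on \<open>N\<close> alone, apart from offsets in
    \<open>t\<close>, and for fixed \<open>t\<close> the double series factors.\<close>
  let ?i = "\<lambda>(t::int, (K::int, N::int)). (N + K, K + t - int L * N)"
  let ?j = "\<lambda>(n::int, n'::int). ((n' + int L * n) mod (int L + 1),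
      ((n' + int L * n) div (int L + 1), n - (n' + int L * n) div (int L + 1)))"
  have term_eq: "?G t (K, N) = ?H (N + K, K + t - int L * N)" for t K N
  proof -
    define x y u where "x = real_of_int K" and "y = real_of_int N" and "u = real_of_int t"
    define M where "M = real L"
    have "M > 0" using assms by (simp add: M_def)
    have 1: "(p * (M + 1) * x + (p * u + a + a'))\<^sup>2 / (2 * p * (M + 1))
       + (p * M * (M + 1) * y + (a - M * a' - M * p * u))\<^sup>2 / (2 * p * M * (M + 1))
       = (p * M * (y + x) + a)\<^sup>2 / (2 * p * M) + (p * (x + u - M * y) + a')\<^sup>2 / (2 * p)"
    proof -
      have *: "(A + B)\<^sup>2 / (2 * p * (M + 1)) + (A - M * B)\<^sup>2 / (2 * p * M * (M + 1)) = A\<^sup>2 / (2 * p * M) + B\<^sup>2 / (2 * p)"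
        for A B
      proof -
        have "(A + B)\<^sup>2 / (2 * p * (M + 1)) + (A - M * B)\<^sup>2 / (2 * p * M * (M + 1))
           = (M * (A + B)\<^sup>2 + (A - M * B)\<^sup>2) / (2 * p * M * (M + 1))"
          using assms \<open>M > 0\<close> by (simp add: add_divide_distrib)
        also have "M * (A + B)\<^sup>2 + (A - M * B)\<^sup>2 = (M + 1) * (A\<^sup>2 + M * B\<^sup>2)"
          by (simp add: power2_eq_square algebra_simps)
        also have "(M + 1) * (A\<^sup>2 + M * B\<^sup>2) / (2 * p * M * (M + 1)) = (A\<^sup>2 + M * B\<^sup>2) / (2 * p * M)"
          using \<open>M > 0\<close> by simp
        also have "\<dots> = A\<^sup>2 / (2 * p * M) + B\<^sup>2 / (2 * p)"
          using \<open>M > 0\<close> by (simp add: add_divide_distrib)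
        finally show ?thesis .
      qed
      have "p * (M + 1) * x + (p * u + a + a') = (p * M * (y + x) + a) + (p * (x + u - M * y) + a')"
        "p * M * (M + 1) * y + (a - M * a' - M * p * u) = (p * M * (y + x) + a) - M * (p * (x + u - M * y) + a')"
        by (simp_all add: algebra_simps)
      thus ?thesis by (simp only: *)
    qed
    have 2: "p * (M + 1) * x + (p * u + a + a') = (p * M * (y + x) + a) + (p * (x + u - M * y) + a')"
      by (simp add: algebra_simps)
    have q: "q_pow \<tau> r * q_pow \<tau> s = q_pow \<tau> (r + s)" for r s
      by (simp add: q_pow_def algebra_simps flip: exp_add)
    have ze: "zeta_pow z r * zeta_pow z s = zeta_pow z (r + s)" for r s
      by (simp add: zeta_pow_def algebra_simps flip: exp_add)
    have z0: "zeta_pow 0 r = 1" for r by (simp add: zeta_pow_def)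
    have eqs: "2 * (p * real (L + 1) / 2) = p * (M + 1)" "4 * (p * real (L + 1) / 2) = 2 * p * (M + 1)"
      "2 * (p * real L * real (L + 1) / 2) = p * M * (M + 1)"
      "4 * (p * real L * real (L + 1) / 2) = 2 * p * M * (M + 1)"
      "2 * (p * real L / 2) = p * M" "4 * (p * real L / 2) = 2 * p * M" "2 * (p / 2) = p" "4 * (p / 2) = 2 * p"
      "real_of_int (N + K) = y + x" "real_of_int (K + t - int L * N) = x + u - M * y"
      by (simp_all add: M_def x_def y_def u_def)
    have "?G t (K, N) = q_pow \<tau> ((p * (M + 1) * x + (p * u + a + a'))\<^sup>2 / (2 * p * (M + 1))
       + (p * M * (M + 1) * y + (a - M * a' - M * p * u))\<^sup>2 / (2 * p * M * (M + 1)))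
       * zeta_pow z (p * (M + 1) * x + (p * u + a + a'))"
      unfolding prod.case F_def eqs z0 q[symmetric] by (simp add: x_def y_def u_def M_def mult_ac)
    also have "\<dots> = q_pow \<tau> ((p * M * (y + x) + a)\<^sup>2 / (2 * p * M) + (p * (x + u - M * y) + a')\<^sup>2 / (2 * p))
        * zeta_pow z ((p * M * (y + x) + a) + (p * (x + u - M * y) + a'))"
      unfolding 1 unfolding 2 ..
    also have "\<dots> = ?H (N + K, K + t - int L * N)"
      unfolding prod.case F_def eqs q[symmetric] ze[symmetric] by (simp add: mult_ac)
    finally show ?thesis .
  qed
  have bij: "bij_betw ?i ({0..int L} \<times> UNIV) UNIV"
  proof (rule bij_betw_byWitness[where f' = ?j])
    show "\<forall>x\<in>{0..int L} \<times> UNIV. ?j (?i x) = x"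
    proof
      fix w assume "w \<in> {0..int L} \<times> (UNIV :: (int \<times> int) set)"
      then obtain t K N where w: "w = (t, K, N)" and t: "0 \<le> t" "t < int L + 1"
        by (cases w) auto
      have eq: "K + t - int L * N + int L * (N + K) = t + K * (int L + 1)"
        by (simp add: algebra_simps)
      show "?j (?i w) = w"
        unfolding w prod.case eq using t by (simp add: mod_pos_pos_trivial div_pos_pos_trivial)
    qed
    show "\<forall>x\<in>UNIV. ?i (?j x) = x"
    proof
      fix w :: "int \<times> int"
      obtain n n' where w: "w = (n, n')" by (cases w)
      let ?s = "n' + int L * n" and ?D = "int L + 1"
      have "?s mod ?D = ?s - ?D * (?s div ?D)"
        by (simp add: minus_mult_div_eq_mod)
      hence "?s div ?D + ?s mod ?D - int L * (n - ?s div ?D) = n'"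
        by (simp add: algebra_simps)
      thus "?i (?j w) = w" by (simp add: w)
    qed
    have "x mod (int L + 1) \<le> int L" for x
      using pos_mod_bound[of "int L + 1" x] by linarith
    thus "?j ` UNIV \<subseteq> {0..int L} \<times> UNIV" by auto
  qed auto
  have pos: "p * L / 2 > 0" "p / 2 > 0" "p * (L + 1) / 2 > 0" "p * L * (L + 1) / 2 > 0"
    using assms by simp_all
  have sH: "?H summable_on UNIV"
    using summable_on_product[OF sF[OF pos(1)] sF[OF pos(2)]] by simp
  have GH: "(\<lambda>x. ?H (?i x)) = (\<lambda>(t, y). ?G t y)"
    using term_eq by (auto simp: fun_eq_iff)
  \<comment> \<open>Summability travels along the bijection from the product of the two series; it
    justifies summing over \<open>(K, N)\<close> first, which leaves a finite sum over
    \<open>t\<close>.\<close>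
  have sG: "(\<lambda>(t, y). ?G t y) summable_on {0..int L} \<times> UNIV"
    using sH summable_on_reindex_bij_betw[OF bij, of ?H] unfolding GH by blast
  have "vartheta (p * L / 2) a z \<tau> * vartheta (p / 2) a' z \<tau> = infsum ?H UNIV"
    using infsum_product[OF sF[OF pos(1)] sF[OF pos(2)]] by (simp add: v)
  also have "\<dots> = infsum (\<lambda>(t, y). ?G t y) ({0..int L} \<times> UNIV)"
    using infsum_reindex_bij_betw[OF bij, of ?H] unfolding GH by simp
  also have "\<dots> = infsum (\<lambda>t. infsum (?G t) UNIV) {0..int L}"
    using infsum_Sigma'_banach[OF sG] by simp
  also have "\<dots> = (\<Sum>t=0..int L. infsum (?G t) UNIV)"
    by simp
  also have "\<dots> = (\<Sum>t=0..int L. vartheta (p * (L + 1) / 2) (p * of_int t + a + a') z \<tau>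
        * theta (p * L * (L + 1) / 2) (a - L * a' - L * p * of_int t) \<tau>)"
    using infsum_product[OF sF[OF pos(3)] sF[OF pos(4)]] by (simp add: v theta_def)
  finally show ?thesis .
qed

section \<open>The base function and its square\<close>

lemma jacobi_theta_half_shift: "jacobi_theta (z + 1 / 2) \<tau> = - vartheta (1 / 2) (1 / 2) z \<tau>"
proof -
  have "exp (2 * of_real pi * \<i> * of_real (1 / 2 + real_of_int k)) = (-1::complex)" for k
  proof -
    have "exp (2 * of_real pi * \<i> * of_real (1 / 2 + real_of_int k))
        = exp (of_real pi * \<i>) * exp (\<i> * (of_int k * (of_real pi * 2)))"
      by (simp add: algebra_simps flip: exp_add)
    thus ?thesis by (simp add: exp_pi_i' exp_integer_2pi mult_ac)
  qed note e = this
  have "jacobi_theta (z + 1 / 2) \<tau> = (\<Sum>\<^sub>\<infinity>k\<in>(UNIV::int set). 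
        exp (of_real pi * \<i> * of_real ((1 / 2 + real_of_int k)\<^sup>2) * \<tau> + 2 * of_real pi * \<i> * of_real (1 / 2 + real_of_int k) * (z + 1 / 2 + 1 / 2)))"
    unfolding jacobi_theta_def
    by (subst infsum_reindex) (auto simp: inj_on_def o_def)
  also have "\<dots> = (\<Sum>\<^sub>\<infinity>k\<in>(UNIV::int set). - (q_pow \<tau> ((2 * (1/2) * of_int k + 1/2)\<^sup>2 / (4 * (1/2))) * zeta_pow z (2 * (1/2) * of_int k + 1/2)))"
  proof (rule infsum_cong)
    fix k :: int
    define x where "x = 1 / 2 + real_of_int k"
    \<comment> \<open>The half from the definition and the half from the argument add up to 1 and
      split off the sign \<open>exp (2 * pi * \<i> * x)\<close>. The rest is the summand for
      \<open>m = 1/2\<close>, where \<open>(2*m*k + a)^2 / (4*m)\<close> is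
      \<open>x^2 / 2\<close>.\<close>
    have "exp (of_real pi * \<i> * of_real (x\<^sup>2) * \<tau> + 2 * of_real pi * \<i> * of_real x * (z + 1 / 2 + 1 / 2))
       = exp (2 * of_real pi * \<i> * of_real (x\<^sup>2 / 2) * \<tau>) * exp (2 * of_real pi * \<i> * of_real x * z)
          * exp (2 * of_real pi * \<i> * of_real x)"
      by (simp add: algebra_simps flip: exp_add)
    also have "exp (2 * of_real pi * \<i> * of_real x) = (-1::complex)"
      unfolding x_def by (rule e)
    finally show "exp (of_real pi * \<i> * of_real ((1 / 2 + real_of_int k)\<^sup>2) * \<tau> + 2 * of_real pi * \<i> * of_real (1 / 2 + real_of_int k) * (z + 1 / 2 + 1 / 2)) = - (q_pow \<tau> ((2 * (1/2) * of_int k + 1/2)\<^sup>2 / (4 * (1/2))) * zeta_pow z (2 * (1/2) * of_int k + 1/2))"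
      by (simp add: q_pow_def zeta_pow_def x_def add.commute)
  qed
  finally show ?thesis by (simp add: vartheta_def infsum_uminus)
qed


lemma vartheta_half_square:
  assumes "Im \<tau> > 0"
  shows "vartheta (1 / 2) (1 / 2) z \<tau> ^ 2 = (\<Sum>t=0..1. h_int (Suc 0) t \<tau> * vartheta 1 (of_int t) z \<tau>)"
proof -
  \<comment> \<open>One factor is rewritten with parameter \<open>-1/2\<close>, so that the
    parameters add up to 0 and the product formula yields the indices 0 and 1.\<close>
  have shift: "vartheta (1 / 2) (- (1 / 2)) z \<tau> = vartheta (1 / 2) (1 / 2) z \<tau>"
    using vartheta_shift[of "1 / 2" "1 / 2" "- 1" z \<tau>] by simp
  have "vartheta (1 / 2) (1 / 2) z \<tau> ^ 2
      = (\<Sum>t=0..1. vartheta 1 (of_int t) z \<tau> * theta 1 (1 - of_int t) \<tau>)"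
    using vartheta_mult[of \<tau> 1 1 "1 / 2" z "- (1 / 2)"] assms by (simp add: shift power2_eq_square)
  also have "\<dots> = (\<Sum>t=0..1. h_int (Suc 0) t \<tau> * vartheta 1 (of_int t) z \<tau>)"
    by (intro sum.cong refl) (auto intro!: theta_eqI_minus[where k = 1])
  finally show ?thesis .
qed

section \<open>Symmetry of the coefficients and the unfolded recursion\<close>

lemma h_int_one_cong:
  assumes "even (b - b')"
  shows "h_int (Suc 0) b \<tau> = h_int (Suc 0) b' \<tau>"
proof -
  obtain k where "b - b' = 2 * k" using assms by (rule evenE)
  hence "b = b' + 2 * k" by simp
  thus ?thesis by (auto intro!: theta_eqI[where k = k])
qed

declare h_int.simps(3) [simp del]

text \<open>At level 1 this is parity. At higher levels it is the clause that defines the values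
  above the middle index, read in both directions.\<close>

lemma h_int_reflect:
  assumes "l \<ge> 1" "0 \<le> c" "c \<le> 2 * int l"
  shows "h_int l (2 * int l - c) \<tau> = h_int l c \<tau>"
proof (cases "l = 1")
  case True
  thus ?thesis using h_int_one_cong[of "2 - c" c] by simp
next
  case False
  then obtain k where k: "l = Suc (Suc k)"
    using assms by (cases l; cases "l - 1") auto
  have *: "h_int (Suc (Suc k)) b \<tau> = h_int (Suc (Suc k)) (2 * int l - b) \<tau>"
    if "int l < b" "b \<le> 2 * int l" for b
    using that k by (subst h_int.simps(3)) (simp add: Let_def algebra_simps)
  consider "c = int l" | "c < int l" | "c > int l" by linarith
  thus ?thesis
  proof cases
    case 2
    thus ?thesis using *[of "2 * int l - c"] assms by (simp add: k)
  next
    case 3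
    thus ?thesis using *[of c] assms by (simp add: k)
  qed simp
qed

text \<open>Modulo \<open>2 * l\<close> the reflection \<open>c -> -c\<close> fixes exactly the
  classes of 0 and \<open>l\<close> and pairs all others. The fixed classes become the two isolated
  terms of the recursion for \<open>h_int\<close>.\<close>

lemma sum_fold_reflect:
  fixes f :: "int \<Rightarrow> 'a::comm_monoid_add"
  assumes "l \<ge> 1"
  shows "sum f {0..2 * l - 1} = f 0 + f l + (\<Sum>c=1..l - 1. f c + f (2 * l - c))"
proof -
  have "{0..2 * l - 1} = insert 0 (insert l ({1..l - 1} \<union> {l + 1..2 * l - 1}))"
    using assms by auto
  hence "sum f {0..2 * l - 1} = f 0 + (f l + (sum f {1..l - 1} + sum f {l + 1..2 * l - 1}))"
    using assms by (simp add: sum.union_disjoint)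
  also have "sum f {l + 1..2 * l - 1} = (\<Sum>c=1..l - 1. f (2 * l - c))"
    by (rule sum.reindex_bij_witness[where i = "\<lambda>c. 2 * l - c" and j = "\<lambda>c. 2 * l - c"]) auto
  finally show ?thesis by (simp add: sum.distrib add.assoc)
qed

text \<open>This unfolded form of the recursion is what multiplying expansions produces. For
  \<open>b \<le> l + 1\<close> the sum folds to the defining clause; larger \<open>b\<close> follow
  because both sides are invariant under \<open>b -> 2*(l+1) - b\<close>.\<close>

lemma h_int_Suc:
  assumes "l \<ge> 1" "0 \<le> b" "b \<le> 2 * (int l + 1)"
  shows "h_int (Suc l) b \<tau> = (\<Sum>c=0..2 * int l - 1. h_int l c \<tau> * h_int (Suc 0) (b - c) \<tau>
     * theta (of_int (int l * (int l + 1))) (of_int ((int l + 1) * c - int l * b)) \<tau>)"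
proof -
  define f where "f b c = h_int l c \<tau> * h_int (Suc 0) (b - c) \<tau>
     * theta (of_int (int l * (int l + 1))) (of_int ((int l + 1) * c - int l * b)) \<tau>" for b c
  obtain k where k: "l = Suc k" using assms by (cases l) auto
  have low: "h_int (Suc l) b \<tau> = sum (f b) {0..2 * int l - 1}" if "0 \<le> b" "b \<le> int l + 1" for b
  proof -
    have f1: "f b c = h_int (Suc 0) (b - c) \<tau>
        * theta (of_int (int l * (int l + 1))) (of_int (b * int l - c * (int l + 1))) \<tau> * h_int l c \<tau>" for c
    proof -
      have "theta (of_int (int l * (int l + 1))) (of_int ((int l + 1) * c - int l * b)) \<tau>
        = theta (of_int (int l * (int l + 1))) (of_int (b * int l - c * (int l + 1))) \<tau>"
        by (rule theta_eqI_minus[where k = 0]) (simp add: algebra_simps)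
      thus ?thesis by (simp add: f_def)
    qed
    \<comment> \<open>The mirrored term has the same two \<open>h_int\<close> factors as
      \<open>f b c\<close>; only the sign of \<open>c\<close> inside the Thetanullwert changes. This
      gives the sum of two Thetanullwerte in the recursion.\<close>
    have f2: "f b (2 * int l - c) = h_int (Suc 0) (b - c) \<tau>
        * theta (of_int (int l * (int l + 1))) (of_int (b * int l + c * (int l + 1))) \<tau> * h_int l c \<tau>"
      if "c \<in> {1..int l - 1}" for c
    proof -
      have "theta (of_int (int l * (int l + 1))) (of_int ((int l + 1) * (2 * int l - c) - int l * b)) \<tau>
        = theta (of_int (int l * (int l + 1))) (of_int (b * int l + c * (int l + 1))) \<tau>"
        by (rule theta_eqI_minus[where k = 1]) (simp add: algebra_simps)
      moreover have "h_int (Suc 0) (b - (2 * int l - c)) \<tau> = h_int (Suc 0) (b - c) \<tau>"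
        by (rule h_int_one_cong) simp
      moreover have "h_int l (2 * int l - c) \<tau> = h_int l c \<tau>"
        using that assms by (intro h_int_reflect) auto
      ultimately show ?thesis by (simp add: f_def)
    qed
    have "sum (f b) {0..2 * int l - 1} = f b 0 + f b (int l) + (\<Sum>c=1..int l - 1. f b c + f b (2 * int l - c))"
      using assms by (intro sum_fold_reflect) simp
    also have "(\<Sum>c=1..int l - 1. f b c + f b (2 * int l - c)) = (\<Sum>c=1..int l - 1. h_int (Suc 0) (b - c) \<tau>
        * (theta (of_int (int l * (int l + 1))) (of_int (b * int l - c * (int l + 1))) \<tau>
          + theta (of_int (int l * (int l + 1))) (of_int (b * int l + c * (int l + 1))) \<tau>) * h_int l c \<tau>)"
    proof (intro sum.cong refl)
      have distrib: "x * u * y + x * v * y = x * (u + v) * y" for x y u v :: complex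
        by (simp add: ring_distribs)
      fix c assume "c \<in> {1..int l - 1}"
      from f2[OF this] show "f b c + f b (2 * int l - c) = h_int (Suc 0) (b - c) \<tau>
          * (theta (of_int (int l * (int l + 1))) (of_int (b * int l - c * (int l + 1))) \<tau>
            + theta (of_int (int l * (int l + 1))) (of_int (b * int l + c * (int l + 1))) \<tau>) * h_int l c \<tau>"
        unfolding f1[of c] by (simp only: distrib)
    qed
    also have "f b 0 + f b (int l) + \<dots> = h_int (Suc l) b \<tau>"
      using that unfolding f1 k by (subst h_int.simps(3)) (simp add: Let_def)
    finally show ?thesis ..
  qed
  \<comment> \<open>Reflecting \<open>b\<close> is undone by \<open>c -> -c\<close> modulo
    \<open>2 * l\<close>. The representative of the class of 0 must stay 0, since
    \<open>2 * l\<close> lies outside the range; hence the case distinction.\<close>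
  have refl: "sum (f (2 * (int l + 1) - b)) {0..2 * int l - 1} = sum (f b) {0..2 * int l - 1}" for b
  proof (rule sum.reindex_bij_witness[where i = "\<lambda>c. if c = 0 then 0 else 2 * int l - c"
        and j = "\<lambda>c. if c = 0 then 0 else 2 * int l - c"])
    fix c assume c: "c \<in> {0..2 * int l - 1}"
    show "f b (if c = 0 then 0 else 2 * int l - c) = f (2 * (int l + 1) - b) c"
    proof (cases "c = 0")
      case True
      have "theta (of_int (int l * (int l + 1))) (of_int (- (int l * b))) \<tau>
        = theta (of_int (int l * (int l + 1))) (of_int (- (int l * (2 * (int l + 1) - b)))) \<tau>"
        by (rule theta_eqI_minus[where k = "-1"]) (simp add: algebra_simps)
      moreover have "h_int (Suc 0) (2 * (int l + 1) - b) \<tau> = h_int (Suc 0) b \<tau>"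
        by (rule h_int_one_cong) simp
      ultimately show ?thesis using True by (simp add: f_def del: h_int.simps)
    next
      case False
      have "theta (of_int (int l * (int l + 1))) (of_int ((int l + 1) * (2 * int l - c) - int l * b)) \<tau>
        = theta (of_int (int l * (int l + 1))) (of_int ((int l + 1) * c - int l * (2 * (int l + 1) - b))) \<tau>"
        by (rule theta_eqI_minus[where k = 0]) (simp add: algebra_simps)
      moreover have "h_int (Suc 0) (2 * (int l + 1) - b - c) \<tau> = h_int (Suc 0) (b - (2 * int l - c)) \<tau>"
        by (rule h_int_one_cong) simp
      moreover have "h_int l (2 * int l - c) \<tau> = h_int l c \<tau>"
        using c assms by (intro h_int_reflect) auto
      ultimately show ?thesis using False by (simp add: f_def del: h_int.simps)
    qed
  qed (auto split: if_splits)
  have "h_int (Suc l) b \<tau> = sum (f b) {0..2 * int l - 1}"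
  proof (cases "b \<le> int l + 1")
    case True
    thus ?thesis using low assms by simp
  next
    case False
    have "h_int (Suc l) b \<tau> = h_int (Suc l) (2 * (int l + 1) - b) \<tau>"
      using h_int_reflect[of "Suc l" b \<tau>] assms by (simp add: algebra_simps)
    also have "\<dots> = sum (f (2 * (int l + 1) - b)) {0..2 * int l - 1}"
      using False assms by (intro low) auto
    finally show ?thesis by (simp only: refl)
  qed
  thus ?thesis unfolding f_def .
qed

section \<open>Expansions of the even and odd powers\<close>

lemma sum_even_odd_split:
  fixes f :: "int \<Rightarrow> 'a::comm_monoid_add"
  shows "(\<Sum>j=0..1. \<Sum>t=0..l. f (2 * t + j)) = sum f {0..2 * l + 1}"
  unfolding sum.cartesian_product
  by (rule sum.reindex_bij_witness[where i = "\<lambda>b. (b mod 2, b div 2)" and j = "\<lambda>(j, t). 2 * t + j"]) auto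

lemma vartheta_half_power_even:
  assumes "Im \<tau> > 0" "l \<ge> 1"
  shows "vartheta (1 / 2) (1 / 2) z \<tau> ^ (2 * l)
    = (\<Sum>b=0..2 * int l - 1. h_int l b \<tau> * vartheta (real l) (of_int b) z \<tau>)"
  using assms(2)
proof (induction l rule: nat_induct_at_least)
  case base
  thus ?case using vartheta_half_square[OF assms(1)] by simp
next
  case (Suc l)
  let ?T = "vartheta (1 / 2) (1 / 2) z \<tau>"
  let ?h = "h_int (Suc 0)"
  let ?\<theta> = "\<lambda>c b. theta (of_int (int l * (int l + 1))) (of_int ((int l + 1) * c - int l * b)) \<tau>"
  let ?V = "\<lambda>b. vartheta (real (Suc l)) (of_int b) z \<tau>"
  \<comment> \<open>Both factors have period 2, so the expansion of \<open>?T ^ 2\<close> may run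
    over the residues \<open>j - c\<close>. This shift makes the parameters \<open>c\<close> and
    \<open>j - c\<close> add up to \<open>j\<close>, so the theta functions produced no longer
    depend on \<open>c\<close>.\<close>
  have T2: "?T ^ 2 = (\<Sum>j=0..1. ?h (j - c) \<tau> * vartheta 1 (of_int (j - c)) z \<tau>)" for c
  proof -
    have v: "vartheta 1 (of_int b) z \<tau> = vartheta 1 (of_int b') z \<tau>" if ev: "even (b - b')" for b b'
    proof -
      obtain k where "b - b' = 2 * k" using ev by (rule evenE)
      hence "b = b' + 2 * k" by simp
      thus ?thesis using vartheta_shift[of 1 "of_int b'" k z \<tau>] by simp
    qed
    have "(\<Sum>j=0..1. ?h (j - c) \<tau> * vartheta 1 (of_int (j - c)) z \<tau>)
       = (\<Sum>j=0..1. ?h j \<tau> * vartheta 1 (of_int j) z \<tau>)"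
    proof (rule sum.reindex_bij_witness[where i = "\<lambda>j. (j + c) mod 2" and j = "\<lambda>j. (j - c) mod 2"])
      fix j :: int assume "j \<in> {0..1}"
      hence "j = 0 \<or> j = 1" by auto
      thus "((j - c) mod 2 + c) mod 2 = j" "((j + c) mod 2 - c) mod 2 = j"
        by (auto simp: mod_simps)
      show "?h ((j - c) mod 2) \<tau> * vartheta 1 (of_int ((j - c) mod 2)) z \<tau>
          = ?h (j - c) \<tau> * vartheta 1 (of_int (j - c)) z \<tau>"
        using h_int_one_cong[of "(j - c) mod 2" "j - c" \<tau>] v[of "(j - c) mod 2" "j - c"]
        by (simp del: h_int.simps)
    qed (auto simp: zmod_le_nonneg_dividend)
    thus ?thesis using vartheta_half_square[OF assms(1)] by simp
  qed
  have prod: "vartheta (real l) (of_int c) z \<tau> * vartheta 1 (of_int (j - c)) z \<tau>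
      = (\<Sum>t=0..int l. ?V (2 * t + j) * ?\<theta> c (2 * t + j))" for c j
  proof -
    have eqs: "2 * real l / 2 = real l" "2 / 2 = (1::real)" "2 * real (l + 1) / 2 = real (Suc l)"
      "2 * real l * real (l + 1) / 2 = of_int (int l * (int l + 1))"
      "2 * of_int t + of_int c + of_int (j - c) = real_of_int (2 * t + j)"
      "of_int c - real l * of_int (j - c) - real l * 2 * of_int t
         = of_int ((int l + 1) * c - int l * (2 * t + j))" for t
      by (simp_all add: algebra_simps)
    show ?thesis
      using vartheta_mult[of \<tau> 2 l "of_int c" z "of_int (j - c)"] assms(1) Suc.hyps
      unfolding eqs by simp
  qed
  have step: "vartheta (real l) (of_int c) z \<tau> * ?T ^ 2 = (\<Sum>b=0..2 * int l + 1. ?h (b - c) \<tau> * ?V b * ?\<theta> c b)" for c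
  proof -
    have "vartheta (real l) (of_int c) z \<tau> * ?T ^ 2
       = (\<Sum>j=0..1. ?h (j - c) \<tau> * (vartheta (real l) (of_int c) z \<tau> * vartheta 1 (of_int (j - c)) z \<tau>))"
      unfolding T2[of c] sum_distrib_left by (simp add: mult_ac del: h_int.simps)
    \<comment> \<open>By parity \<open>j - c\<close> may become \<open>2 * t + j - c\<close>. Now
      every factor involves \<open>t\<close> and \<open>j\<close> only through
      \<open>b = 2 * t + j\<close>, and the double sum collapses to one over
      \<open>b\<close>.\<close>
    also have "\<dots> = (\<Sum>j=0..1. \<Sum>t=0..int l. ?h (2 * t + j - c) \<tau> * ?V (2 * t + j) * ?\<theta> c (2 * t + j))"
      unfolding prod sum_distrib_left mult.assoc
      by (intro sum.cong refl arg_cong2[where f = "(*)"] h_int_one_cong) simp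
    also have "\<dots> = (\<Sum>b=0..2 * int l + 1. ?h (b - c) \<tau> * ?V b * ?\<theta> c b)"
      by (rule sum_even_odd_split)
    finally show ?thesis .
  qed
  have "?T ^ (2 * Suc l) = ?T ^ (2 * l) * ?T ^ 2"
    by (simp flip: power_add)
  also have "\<dots> = (\<Sum>c=0..2 * int l - 1. h_int l c \<tau> * (\<Sum>b=0..2 * int l + 1. ?h (b - c) \<tau> * ?V b * ?\<theta> c b))"
    unfolding Suc.IH sum_distrib_right by (simp only: mult.assoc step)
  also have "\<dots> = (\<Sum>b=0..2 * int l + 1. \<Sum>c=0..2 * int l - 1. h_int l c \<tau> * (?h (b - c) \<tau> * ?V b * ?\<theta> c b))"
    unfolding sum_distrib_left by (rule sum.swap)
  also have "\<dots> = (\<Sum>b=0..2 * int l + 1. h_int (Suc l) b \<tau> * ?V b)"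
  proof (intro sum.cong refl)
    fix b assume "b \<in> {0..2 * int l + 1}"
    hence "h_int (Suc l) b \<tau> = (\<Sum>c=0..2 * int l - 1. h_int l c \<tau> * ?h (b - c) \<tau> * ?\<theta> c b)"
      using Suc.hyps by (intro h_int_Suc) auto
    thus "(\<Sum>c=0..2 * int l - 1. h_int l c \<tau> * (?h (b - c) \<tau> * ?V b * ?\<theta> c b)) = h_int (Suc l) b \<tau> * ?V b"
      by (simp add: sum_distrib_right sum_distrib_left mult_ac del: h_int.simps)
  qed
  finally show ?case by (simp add: algebra_simps)
qed

lemma vartheta_half_power_odd:
  assumes "Im \<tau> > 0" "l \<ge> 1"
  shows "vartheta (1 / 2) (1 / 2) z \<tau> ^ (2 * l + 1)
    = (\<Sum>b=0..2 * int l. h_half l b \<tau> * vartheta (real l + 1 / 2) (of_int b + 1 / 2) z \<tau>)"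
proof -
  let ?T = "vartheta (1 / 2) (1 / 2) z \<tau>"
  let ?\<theta> = "\<lambda>c b. theta (of_int (int l * (2 * int l + 1))) (of_int (c * (2 * int l + 1) - int l * (2 * b + 1))) \<tau>"
  let ?V = "\<lambda>b. vartheta (real l + 1 / 2) (of_int b + 1 / 2) z \<tau>"
  have step: "vartheta (real l) (of_int c) z \<tau> * ?T = (\<Sum>b=0..2 * int l. ?V b * ?\<theta> c b)" for c
  proof -
    \<comment> \<open>The same device with period 1: the parameter \<open>1/2 - c\<close> cancels
      \<open>c\<close> in the sum of parameters. The product formula with \<open>p = 1\<close> and
      \<open>L = 2 * l\<close> then gives exactly the Thetanullwerte in
      \<open>h_half\<close>.\<close>
    have shift: "vartheta (1 / 2) (1 / 2 - of_int c) z \<tau> = ?T"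
      using vartheta_shift[of "1 / 2" "1 / 2" "- c" z \<tau>] by simp
    have eqs: "1 * real (2 * l) / 2 = real l" "1 * (real (2 * l + 1)) / 2 = real l + 1 / 2"
      "1 * real (2 * l) * real (2 * l + 1) / 2 = of_int (int l * (2 * int l + 1))"
      "1 * of_int b + of_int c + (1 / 2 - of_int c) = of_int b + (1 / 2 :: real)"
      "of_int c - real (2 * l) * (1 / 2 - of_int c) - real (2 * l) * 1 * of_int b
         = of_int (c * (2 * int l + 1) - int l * (2 * b + 1))" for b
      by (simp_all add: algebra_simps)
    show ?thesis
      using vartheta_mult[of \<tau> 1 "2 * l" "of_int c" z "1 / 2 - of_int c"] assms
      unfolding eqs shift by simp
  qed
  have "?T ^ (2 * l + 1) = ?T ^ (2 * l) * ?T" by simp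
  also have "\<dots> = (\<Sum>c=0..2 * int l - 1. h_int l c \<tau> * (\<Sum>b=0..2 * int l. ?V b * ?\<theta> c b))"
    unfolding vartheta_half_power_even[OF assms] sum_distrib_right by (simp only: mult.assoc step)
  also have "\<dots> = (\<Sum>b=0..2 * int l. \<Sum>c=0..2 * int l - 1. h_int l c \<tau> * (?V b * ?\<theta> c b))"
    unfolding sum_distrib_left by (rule sum.swap)
  also have "\<dots> = (\<Sum>b=0..2 * int l. h_half l b \<tau> * ?V b)"
    unfolding h_half_def sum_distrib_right by (simp only: mult_ac)
  finally show ?thesis .
qed

theorem theorem1p1:
  fixes l \<delta> :: nat and z \<tau> :: complex
  assumes "Im \<tau> > 0" and "l \<ge> 1" and "\<delta> \<in> {0, 1}"
  shows "(-1) ^ \<delta> * jacobi_theta (z + 1 / 2) \<tau> ^ (2 * l + \<delta>) =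
    (\<Sum>b = 0..2 * l + \<delta> - 1. h_coeff l \<delta> (int b) \<tau>
       * vartheta (real l + real \<delta> / 2) (real b + real \<delta> / 2) z \<tau>)"
proof -
  let ?T = "vartheta (1 / 2) (1 / 2) z \<tau>"
  let ?f = "\<lambda>b::int. h_coeff l \<delta> b \<tau> * vartheta (real l + real \<delta> / 2) (of_int b + real \<delta> / 2) z \<tau>"
  have "(-1) ^ \<delta> * jacobi_theta (z + 1 / 2) \<tau> ^ (2 * l + \<delta>) = ?T ^ (2 * l + \<delta>)"
    using assms(3) by (auto simp: jacobi_theta_half_shift)
  also have "\<dots> = (\<Sum>b=0..2 * int l + int \<delta> - 1. ?f b)"
    using assms(3) vartheta_half_power_even[OF assms(1,2), of z]
      vartheta_half_power_odd[OF assms(1,2), of z]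
    by (auto simp: h_coeff_def)
  \<comment> \<open>On this side the bound is a natural-number subtraction; it agrees with the
    integer bound because \<open>l \<ge> 1\<close>.\<close>
  also have "\<dots> = (\<Sum>b=0..2 * l + \<delta> - 1. ?f (int b))"
    using assms(2)
    by (intro sum.reindex_bij_witness[where i = int and j = nat]) auto
  finally show ?thesis by simp
qed

end
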